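(* Let $\varepsilon,\delta\in(0,1)$ and let $P\in\mathbb{R}^{m\times n}$ have $S^{\top}S$-orthonormal columns, i.e. $P^{\top}S^{\top}SP=I$, with $S\in\mathbb{R}^{s\times m}$ being a randomized $(\varepsilon,\delta,\mathrm{rank}(P))$-subspace embedding for $\mathrm{Range}(P)$. Then, with high probability, $$\|P^{\top}P-I\|_F\le\frac{\varepsilon}{1-\varepsilon}\sqrt{n},\qquad\text{and}\qquad \|P^{\top}P-I\|_2\le\frac{\varepsilon}{1-\varepsilon}.$$
   Context: Subspace embedding: let $\mathcal{V}$ be a $k$-dimensional subspace of $\mathbb{R}^m$, $\varepsilon\in(0,1)$ and $s\le m$. A (random) linear map $S\in\mathbb{R}^{s\times m}$ is an $(\varepsilon,\delta,k)$-subspace embedding for $\mathcal{V}$ if $(1-\varepsilon)\|v\|^2\le\|Sv\|^2\le(1+\varepsilon)\|v\|^2$ for all $v\in\mathcal{V}$ holds with probability at least $1-\delta$ (Euclidean norms). "With high probability" refers to the event that this embedding inequality holds for all $v\in\mathrm{Range}(P)$. $\|\cdot\|_F$ is the Frobenius norm and $\|\cdot\|_2$ the spectral norm. *)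

theory Defs
  imports "HOL-Probability.Probability"
begin

definition frobenius_norm :: "real^'n^'m \<Rightarrow> real" where
  "frobenius_norm A = sqrt (\<Sum>i\<in>UNIV. \<Sum>j\<in>UNIV. (A $ i $ j)\<^sup>2)"

definition spectral_norm :: "real^'n^'m \<Rightarrow> real" where
  "spectral_norm A = onorm (\<lambda>x. A *v x)"

definition embeds :: "real \<Rightarrow> real^'m^'s \<Rightarrow> (real^'m) set \<Rightarrow> bool" where
  "embeds \<epsilon> S V \<longleftrightarrow>
     (\<forall>v\<in>V. (1 - \<epsilon>) * (norm v)\<^sup>2 \<le> (norm (S *v v))\<^sup>2 \<and>
            (norm (S *v v))\<^sup>2 \<le> (1 + \<epsilon>) * (norm v)\<^sup>2)"

text \<open>The subspace \<open>V\<close> is deterministic; only the sketching matrix \<open>S\<close> is random.\<close>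

definition subspace_embedding ::
  "'w measure \<Rightarrow> ('w \<Rightarrow> real^'m^'s) \<Rightarrow> real \<Rightarrow> real \<Rightarrow> nat \<Rightarrow> (real^'m) set \<Rightarrow> bool" where
  "subspace_embedding M S \<epsilon> \<delta> k V \<longleftrightarrow>
     S \<in> borel_measurable M \<and>
     subspace V \<and> dim V = k \<and>
     0 < \<epsilon> \<and> \<epsilon> < 1 \<and> CARD('s) \<le> CARD('m) \<and>
     \<P>(\<omega> in M. embeds \<epsilon> (S \<omega>) V) \<ge> 1 - \<delta>"

definition sketch_orthonormal :: "real^'m^'s \<Rightarrow> real^'n^'m \<Rightarrow> bool" where
  "sketch_orthonormal S P \<longleftrightarrow> transpose P ** transpose S ** S ** P = mat 1"

end

theory Submission
  imports Defs
begin

text \<open>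
  Put \<open>G = P\<^sup>T P - I\<close> and \<open>c = \<epsilon> / (1 - \<epsilon>)\<close>. The quadratic form of \<open>G\<close> is \<open>\<langle>x, G x\<rangle> = \<parallel>P x\<parallel>\<^sup>2 - \<parallel>x\<parallel>\<^sup>2\<close>.
  Orthonormality of the sketched columns says \<open>\<parallel>x\<parallel> = \<parallel>S P x\<parallel>\<close>, so the embedding inequality at
  \<open>v = P x\<close> traps \<open>\<parallel>P x\<parallel>\<^sup>2\<close> between \<open>\<parallel>x\<parallel>\<^sup>2 / (1 + \<epsilon>)\<close> and \<open>\<parallel>x\<parallel>\<^sup>2 / (1 - \<epsilon>)\<close>. The bound on the
  upper deviation is the weaker of the two, and hence \<open>\<bar>\<langle>x, G x\<rangle>\<bar> \<le> c \<parallel>x\<parallel>\<^sup>2\<close> (\<open>gram_form_bound\<close>).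

  As \<open>G\<close> is symmetric, polarization turns this bound on the quadratic form into
  \<open>\<parallel>G x\<parallel> \<le> c \<parallel>x\<parallel>\<close> (\<open>selfadjoint_norm_bound\<close>). This is the spectral estimate.
  Applied to the \<open>n\<close> standard basis vectors, it bounds each column of \<open>G\<close> by \<open>c\<close>, which gives the factor \<open>\<surd>n\<close> in the Frobenius estimate.

  All this is deterministic on the embedding event. To pass to probabilities, the event that both
  estimates hold must be measurable: it is the preimage under \<open>P\<close> of a closed set of matrices.
\<close>

text \<open>
  Polarization: \<open>4 \<langle>x, f y\<rangle>\<close> is the difference of the quadratic form at \<open>x + y\<close> and at \<open>x - y\<close>, and
  the parallelogram law bounds that by \<open>2 c (\<parallel>x\<parallel>\<^sup>2 + \<parallel>y\<parallel>\<^sup>2)\<close>. The choice of \<open>x\<close> parallel to \<open>f y\<close>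
  and of the same length as \<open>y\<close> then isolates \<open>\<parallel>f y\<parallel>\<close>.
\<close>

lemma selfadjoint_norm_bound:
  fixes f :: "'a::real_inner \<Rightarrow> 'a"
  assumes lin: "linear f"
    and sym: "\<And>x y. f x \<bullet> y = x \<bullet> f y"
    and form: "\<And>x. \<bar>x \<bullet> f x\<bar> \<le> c * (norm x)\<^sup>2"
  shows "norm (f y) \<le> c * norm y"
proof (cases "y = 0 \<or> f y = 0")
  case True
  have "0 \<le> c * norm y" if "y \<noteq> 0"
  proof -
    have "0 \<le> c * (norm y)\<^sup>2"
      using form[of y] by linarith
    with that show ?thesis
      by (simp add: zero_le_mult_iff)
  qed
  with True show ?thesis
    using linear_0[OF lin] by (cases "y = 0") auto
next
  case False
  define x where "x = (norm y / norm (f y)) *\<^sub>R f y"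
  have nx: "norm x = norm y"
    using False by (simp add: x_def)
  have xfy: "x \<bullet> f y = norm y * norm (f y)"
    using False by (simp add: x_def dot_square_norm power2_eq_square)
  have "4 * (x \<bullet> f y) = (x + y) \<bullet> f (x + y) - (x - y) \<bullet> f (x - y)"
    using sym[of y x]
    by (simp add: linear_add[OF lin] linear_diff[OF lin] inner_simps inner_commute)
  also have "\<dots> \<le> c * (norm (x + y))\<^sup>2 + c * (norm (x - y))\<^sup>2"
    using form[of "x + y"] form[of "x - y"] by linarith
  also have "\<dots> = 2 * c * ((norm x)\<^sup>2 + (norm y)\<^sup>2)"
    by (simp add: power2_norm_eq_inner inner_simps algebra_simps)
  finally have "norm y * norm (f y) \<le> norm y * (c * norm y)"
    by (simp add: xfy nx power2_eq_square algebra_simps)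
  then show ?thesis
    using False by simp
qed

lemma spectral_norm_le_iff:
  fixes A :: "real^'n^'m"
  assumes "0 \<le> c"
  shows "spectral_norm A \<le> c \<longleftrightarrow> (\<forall>x. norm (A *v x) \<le> c * norm x)"
proof
  assume le: "spectral_norm A \<le> c"
  show "\<forall>x. norm (A *v x) \<le> c * norm x"
  proof
    fix x
    have "norm (A *v x) \<le> spectral_norm A * norm x"
      unfolding spectral_norm_def by (intro onorm matrix_vector_mul_bounded_linear)
    also have "\<dots> \<le> c * norm x"
      using le by (intro mult_right_mono) auto
    finally show "norm (A *v x) \<le> c * norm x" .
  qed
next
  assume "\<forall>x. norm (A *v x) \<le> c * norm x"
  then show "spectral_norm A \<le> c"
    unfolding spectral_norm_def by (intro onorm_bound assms) auto
qed

text \<open>The squared Frobenius norm is the sum of the squared lengths of the columns \<open>A e\<^sub>j\<close>.\<close>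

lemma frobenius_norm_le_columns:
  fixes A :: "real^'n^'m"
  assumes "0 \<le> c" and bound: "\<And>x. norm (A *v x) \<le> c * norm x"
  shows "frobenius_norm A \<le> c * sqrt (real CARD('n))"
proof -
  have "(\<Sum>i\<in>UNIV. \<Sum>j\<in>UNIV. (A $ i $ j)\<^sup>2) = (\<Sum>j\<in>UNIV. \<Sum>i\<in>UNIV. (A $ i $ j)\<^sup>2)"
    by (rule sum.swap)
  also have "\<dots> = (\<Sum>j\<in>UNIV. (norm (A *v axis j 1))\<^sup>2)"
    by (simp add: norm_vec_def L2_set_def sum_nonneg matrix_vector_mult_basis column_def)
  also have "\<dots> \<le> (\<Sum>j\<in>(UNIV :: 'n set). c\<^sup>2)"
  proof (rule sum_mono)
    fix j :: 'n
    show "(norm (A *v axis j 1))\<^sup>2 \<le> c\<^sup>2"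
      using bound[of "axis j 1"] by (intro power_mono) auto
  qed
  finally have "frobenius_norm A \<le> sqrt (real CARD('n) * c\<^sup>2)"
    unfolding frobenius_norm_def by simp
  then show ?thesis
    using \<open>0 \<le> c\<close> by (simp add: real_sqrt_mult mult.commute)
qed

lemma norm_sketch_orthonormal:
  assumes "sketch_orthonormal S P"
  shows "norm (S *v (P *v x)) = norm x"
proof -
  have "(S *v (P *v x)) \<bullet> (S *v (P *v x))
      = x \<bullet> ((transpose P ** transpose S ** S ** P) *v x)"
    by (simp add: dot_lmul_matrix[symmetric] matrix_vector_mul_assoc[symmetric]
        flip: transpose_matrix_vector)
  also have "\<dots> = x \<bullet> x"
    using assms by (simp add: sketch_orthonormal_def)
  finally show ?thesis
    by (simp add: norm_eq)
qed

lemma inner_gram_defect: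
  fixes P :: "real^'n^'m"
  shows "x \<bullet> ((transpose P ** P - mat 1) *v y) = (P *v x) \<bullet> (P *v y) - x \<bullet> y"
  by (simp add: matrix_vector_mult_diff_rdistrib inner_diff_right
      matrix_vector_mul_assoc[symmetric] dot_lmul_matrix[symmetric]
      flip: transpose_matrix_vector)

text \<open>
  The two one-sided deviations of \<open>\<parallel>P x\<parallel>\<^sup>2\<close> from \<open>\<parallel>x\<parallel>\<^sup>2\<close> have relative size \<open>\<epsilon> / (1 - \<epsilon>)\<close> and
  \<open>\<epsilon> / (1 + \<epsilon>)\<close>; the first dominates.
\<close>

lemma gram_form_bound:
  fixes P :: "real^'n^'m" and S :: "real^'m^'s"
  assumes eps: "0 < \<epsilon>" "\<epsilon> < 1"
    and emb: "embeds \<epsilon> S (range (\<lambda>x. P *v x))"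
    and orth: "sketch_orthonormal S P"
  shows "\<bar>x \<bullet> ((transpose P ** P - mat 1) *v x)\<bar> \<le> \<epsilon> / (1 - \<epsilon>) * (norm x)\<^sup>2"
proof -
  define a where "a = (norm (P *v x))\<^sup>2"
  define b where "b = (norm x)\<^sup>2"
  have up: "(1 - \<epsilon>) * a \<le> b" and low: "b \<le> (1 + \<epsilon>) * a"
    using emb[unfolded embeds_def, rule_format, of "P *v x"]
    by (simp_all add: norm_sketch_orthonormal[OF orth] a_def b_def)
  have "(1 - \<epsilon>) * (a - b) \<le> \<epsilon> * b"
    using up by (simp add: algebra_simps)
  moreover have "(1 - \<epsilon>) * (b - a) \<le> \<epsilon> * b"
  proof -
    have "(1 - \<epsilon>) * (b - a) \<le> (1 - \<epsilon>) * (\<epsilon> * a)"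
      using low eps by (intro mult_left_mono) (auto simp: algebra_simps)
    also have "\<dots> = \<epsilon> * ((1 - \<epsilon>) * a)"
      by simp
    also have "\<dots> \<le> \<epsilon> * b"
      using up eps by (intro mult_left_mono) auto
    finally show ?thesis .
  qed
  ultimately have "\<bar>a - b\<bar> \<le> \<epsilon> / (1 - \<epsilon>) * b"
    using eps by (simp add: abs_le_iff field_simps)
  then show ?thesis
    by (simp add: inner_gram_defect a_def b_def power2_norm_eq_inner)
qed

lemma gram_defect_norm_bound:
  fixes P :: "real^'n^'m" and S :: "real^'m^'s"
  assumes "0 < \<epsilon>" "\<epsilon> < 1"
    and "embeds \<epsilon> S (range (\<lambda>x. P *v x))"
    and "sketch_orthonormal S P"
  shows "norm ((transpose P ** P - mat 1) *v x) \<le> \<epsilon> / (1 - \<epsilon>) * norm x"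
proof (rule selfadjoint_norm_bound)
  show "linear (\<lambda>x. (transpose P ** P - mat 1) *v x)"
    by (rule matrix_vector_mul_linear)
  show "((transpose P ** P - mat 1) *v x) \<bullet> y = x \<bullet> ((transpose P ** P - mat 1) *v y)" for x y
    using inner_gram_defect[of y P x] inner_gram_defect[of x P y] by (simp add: inner_commute)
  show "\<bar>x \<bullet> ((transpose P ** P - mat 1) *v x)\<bar> \<le> \<epsilon> / (1 - \<epsilon>) * (norm x)\<^sup>2" for x
    using assms by (rule gram_form_bound)
qed

text \<open>
  The spectral norm is a supremum over vectors, so its sublevel set is an intersection of closed
  conditions, one for each vector.
\<close>

lemma closed_gram_defect_bounds:
  fixes c d :: real
  assumes "0 \<le> c"
  shows "closed {A :: real^'n^'m. frobenius_norm (transpose A ** A - mat 1) \<le> d \<and>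
                                  spectral_norm (transpose A ** A - mat 1) \<le> c}"
proof -
  have "continuous_on UNIV (\<lambda>A :: real^'n^'m. frobenius_norm (transpose A ** A - mat 1))"
    unfolding frobenius_norm_def matrix_matrix_mult_def transpose_def
    by (simp, intro continuous_intros)
  moreover have "continuous_on UNIV (\<lambda>A :: real^'n^'m. norm ((transpose A ** A - mat 1) *v x))" for x
    unfolding matrix_vector_mult_def matrix_matrix_mult_def transpose_def
    by (simp, intro continuous_intros)
  ultimately show ?thesis
    unfolding spectral_norm_le_iff[OF assms]
    by (intro closed_Collect_conj closed_Collect_all closed_Collect_le continuous_on_const)
qed

theorem proposition1:
  fixes M :: "'w measure"
    and S :: "'w \<Rightarrow> real^'m^'s"
    and P :: "'w \<Rightarrow> real^'n^'m"
    and V :: "(real^'m) set"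
    and \<epsilon> \<delta> :: real
    and k :: nat
  assumes "prob_space M"
    and "0 < \<epsilon>" "\<epsilon> < 1" "0 < \<delta>" "\<delta> < 1"
    and "P \<in> borel_measurable M"
    and "subspace_embedding M S \<epsilon> \<delta> k V"
    and "AE \<omega> in M. embeds \<epsilon> (S \<omega>) V \<longrightarrow>
           range (\<lambda>x. P \<omega> *v x) = V \<and> rank (P \<omega>) = k \<and> sketch_orthonormal (S \<omega>) (P \<omega>)"
  shows "(AE \<omega> in M. embeds \<epsilon> (S \<omega>) V \<longrightarrow>
            frobenius_norm (transpose (P \<omega>) ** P \<omega> - mat 1) \<le> \<epsilon> / (1 - \<epsilon>) * sqrt (real CARD('n)) \<and>
            spectral_norm (transpose (P \<omega>) ** P \<omega> - mat 1) \<le> \<epsilon> / (1 - \<epsilon>)) \<and>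
         \<P>(\<omega> in M.
            frobenius_norm (transpose (P \<omega>) ** P \<omega> - mat 1) \<le> \<epsilon> / (1 - \<epsilon>) * sqrt (real CARD('n)) \<and>
            spectral_norm (transpose (P \<omega>) ** P \<omega> - mat 1) \<le> \<epsilon> / (1 - \<epsilon>)) \<ge> 1 - \<delta>"
proof -
  interpret prob_space M by fact
  define c where "c = \<epsilon> / (1 - \<epsilon>)"
  define B where "B = {A :: real^'n^'m.
    frobenius_norm (transpose A ** A - mat 1) \<le> c * sqrt (real CARD('n)) \<and>
    spectral_norm (transpose A ** A - mat 1) \<le> c}"
  have c: "0 \<le> c"
    using assms(2,3) by (simp add: c_def)
  have bounds: "AE \<omega> in M. embeds \<epsilon> (S \<omega>) V \<longrightarrow> P \<omega> \<in> B"
    using assms(8)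
  proof eventually_elim
    case (elim \<omega>)
    show ?case
    proof
      assume emb: "embeds \<epsilon> (S \<omega>) V"
      with elim have "norm ((transpose (P \<omega>) ** P \<omega> - mat 1) *v x) \<le> c * norm x" for x
        unfolding c_def by (intro gram_defect_norm_bound assms(2,3)) auto
      with c show "P \<omega> \<in> B"
        by (simp add: B_def spectral_norm_le_iff frobenius_norm_le_columns)
    qed
  qed
  have "closed B"
    unfolding B_def using c by (rule closed_gram_defect_bounds)
  then have "P -` B \<inter> space M \<in> sets M"
    by (intro measurable_sets[OF assms(6)] borel_closed)
  moreover have "P -` B \<inter> space M = {\<omega> \<in> space M. P \<omega> \<in> B}"
    by blast
  ultimately have meas: "{\<omega> \<in> space M. P \<omega> \<in> B} \<in> sets M"
    by simp
  have "1 - \<delta> \<le> \<P>(\<omega> in M. embeds \<epsilon> (S \<omega>) V)"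
    using assms(7) by (simp add: subspace_embedding_def)
  also have "\<dots> \<le> \<P>(\<omega> in M. P \<omega> \<in> B)"
    using bounds by (intro finite_measure_mono_AE meas) auto
  finally have "1 - \<delta> \<le> \<P>(\<omega> in M. P \<omega> \<in> B)" .
  with bounds show ?thesis
    by (simp add: B_def c_def)
qed

end
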